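(* Let $(\{A_n\}_{n},\{\Psi_n\}_{n})$ be an operator-valued p-ASF in $\mathcal{B}(\mathcal{X},\mathcal{Y})$. An operator-valued p-ASF $(\{B_n\}_{n},\{\Phi_n\}_{n})$ in $\mathcal{B}(\mathcal{X},\mathcal{Y})$ is an approximately dual operator-valued p-ASF for $(\{A_n\}_{n},\{\Psi_n\}_{n})$ if and only if there exist bounded linear operators $U,V:\mathcal{X}\to\mathcal{X}$, $G:\mathcal{X}\to\ell^p(\mathbb{N})\otimes\mathcal{Y}$, $H:\ell^p(\mathbb{N})\otimes\mathcal{Y}\to\mathcal{X}$ satisfying $\|I_{\mathcal{X}}-U\|<1$, $\|I_{\mathcal{X}}-V\|<1$, $$B_n=A_nS_{A,\Psi}^{-1}U+\Gamma_nGU-A_nS_{A,\Psi}^{-1}\theta_\Psi GU,$$ $$\Phi_n=VS_{A,\Psi}^{-1}\Psi_n+VHL_n-VH\theta_AS_{A,\Psi}^{-1}\Psi_n,\quad\forall n\in\mathbb{N},$$ such that the operator $$S_{A,\Psi}^{-1}+HG-H\theta_AS_{A,\Psi}^{-1}\theta_\Psi G$$ is bounded invertible.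
   Context: Banach spaces are over $\mathbb{K}=\mathbb{R}$ or $\mathbb{C}$; $\mathcal{X},\mathcal{Y}$ are Banach spaces, $p\in[1,\infty)$, $\mathcal{B}(\mathcal{X},\mathcal{Y})$ is the space of bounded linear operators. $\ell^p(\mathbb{N})\otimes\mathcal{Y}$ is the completion of the algebraic tensor product in a fixed cross norm ($\|a\otimes y\|=\|a\|\|y\|$) for which, for all $T\in\mathcal{B}(\ell^p(\mathbb{N}))$ and $R\in\mathcal{B}(\mathcal{Y})$, $T\otimes R$ extends to a bounded operator with $\|T\otimes R\|\le\|T\|\|R\|$. With $\{e_n\}_n$ the standard Schauder basis of $\ell^p(\mathbb{N})$, $L_n:\mathcal{Y}\to\ell^p(\mathbb{N})\otimes\mathcal{Y}$ is $L_ny=e_n\otimes y$, and $\Gamma_n:\ell^p(\mathbb{N})\otimes\mathcal{Y}\to\mathcal{Y}$ is the bounded linear operator with $\Gamma_n(\{a_m\}_m\otimes y)=a_ny$. Thus $\Gamma_nL_n=I_{\mathcal{Y}}$, $\Gamma_nL_m=0$ for $n\ne m$, and $\sum_{n=1}^\infty L_n\Gamma_nz=z$ for all $z$. For collections $\{A_n\}_{n}$ in $\mathcal{B}(\mathcal{X},\mathcal{Y})$ and $\{\Psi_n\}_{n}$ in $\mathcal{B}(\mathcal{Y},\mathcal{X})$, the pair is an operator-valued p-approximate Schauder frame (operator-valued p-ASF) in $\mathcal{B}(\mathcal{X},\mathcal{Y})$ if: (i) the frame operator $S_{A,\Psi}x=\sum_{n=1}^\infty\Psi_nA_nx$ is a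 well-defined bounded linear invertible operator on $\mathcal{X}$; (ii) the analysis operator $\theta_A:\mathcal{X}\to\ell^p(\mathbb{N})\otimes\mathcal{Y}$, $\theta_Ax=\sum_{n=1}^\infty L_nA_nx$, is a well-defined bounded linear operator; (iii) the synthesis operator $\theta_\Psi:\ell^p(\mathbb{N})\otimes\mathcal{Y}\to\mathcal{X}$, $\theta_\Psi z=\sum_{n=1}^\infty\Psi_n\Gamma_nz$, is a well-defined bounded linear operator. Two operator-valued p-ASFs $(\{A_n\}_{n},\{\Psi_n\}_{n})$ and $(\{B_n\}_{n},\{\Phi_n\}_{n})$ are approximately dual p-ASFs if $\|I_{\mathcal{X}}-\theta_\Phi\theta_A\|<1$ and $\|I_{\mathcal{X}}-\theta_\Psi\theta_B\|<1$. *)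

theory Defs
  imports "HOL-Analysis.Analysis"
begin

(* Scalar field.  By Ostrowski's theorem a field of class real_normed_field (multiplicative
   norm extending the absolute value of the reals) is isometrically isomorphic to the real or the
   complex numbers, so 'k::real_normed_field stands for K = R or C.  A Banach space over K is a
   type of class banach together with a K-scalar multiplication. *)

locale banach_space_over = vector_space scale
  for scale :: "'k::real_normed_field \<Rightarrow> 'a::banach \<Rightarrow> 'a" +
  assumes norm_scale: "norm (scale c x) = norm c * norm x"
    and scale_of_real: "scale (of_real r) x = r *\<^sub>R x"

definition bounded_linear_over ::
  "('k::real_normed_field \<Rightarrow> 'a::banach \<Rightarrow> 'a) \<Rightarrow> ('k \<Rightarrow> 'b::banach \<Rightarrow> 'b) \<Rightarrow> ('a \<Rightarrow> 'b) \<Rightarrow> bool"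
  where "bounded_linear_over s1 s2 f \<longleftrightarrow> Vector_Spaces.linear s1 s2 f \<and> bounded_linear f"

definition bounded_invertible ::
  "('k::real_normed_field \<Rightarrow> 'a::banach \<Rightarrow> 'a) \<Rightarrow> ('a \<Rightarrow> 'a) \<Rightarrow> bool"
  where "bounded_invertible s T \<longleftrightarrow>
    bounded_linear_over s s T \<and>
    (\<exists>R. bounded_linear_over s s R \<and> T \<circ> R = id \<and> R \<circ> T = id)"


definition lp :: "real \<Rightarrow> (nat \<Rightarrow> 'k::real_normed_field) set"
  where "lp p = {a. summable (\<lambda>n. norm (a n) powr p)}"

definition lp_norm :: "real \<Rightarrow> (nat \<Rightarrow> 'k::real_normed_field) \<Rightarrow> real"
  where "lp_norm p a = (\<Sum>n. norm (a n) powr p) powr (1 / p)"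

definition lp_basis :: "nat \<Rightarrow> nat \<Rightarrow> 'k::real_normed_field"
  where "lp_basis n = (\<lambda>m. if m = n then 1 else 0)"

(* Operators on lp p are functions on all sequences of which only the values on lp p matter. *)

definition bounded_linear_lp ::
  "real \<Rightarrow> ((nat \<Rightarrow> 'k::real_normed_field) \<Rightarrow> (nat \<Rightarrow> 'k)) \<Rightarrow> bool"
  where "bounded_linear_lp p T \<longleftrightarrow>
    (\<forall>a\<in>lp p. T a \<in> lp p) \<and>
    (\<forall>a\<in>lp p. \<forall>b\<in>lp p. T (\<lambda>n. a n + b n) = (\<lambda>n. T a n + T b n)) \<and>
    (\<forall>c. \<forall>a\<in>lp p. T (\<lambda>n. c * a n) = (\<lambda>n. c * T a n)) \<and>
    (\<exists>C. \<forall>a\<in>lp p. lp_norm p (T a) \<le> C * lp_norm p a)"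

definition lp_onorm ::
  "real \<Rightarrow> ((nat \<Rightarrow> 'k::real_normed_field) \<Rightarrow> (nat \<Rightarrow> 'k)) \<Rightarrow> real"
  where "lp_onorm p T = (SUP a\<in>lp p. lp_norm p (T a) / lp_norm p a)"


(* The algebraic tensor product of lp p and Y, realised in the usual way inside the dual of the
   space of all bilinear forms on lp p x Y: an elementary tensor is evaluation at (a, y), and the
   tensor product is the linear span of the elementary tensors (scalars are absorbed into a). *)

definition bilinear_form ::
  "real \<Rightarrow> ('k::real_normed_field \<Rightarrow> 'y::banach \<Rightarrow> 'y) \<Rightarrow> ((nat \<Rightarrow> 'k) \<Rightarrow> 'y \<Rightarrow> 'k) \<Rightarrow> bool"
  where "bilinear_form p sY \<beta> \<longleftrightarrow>
    (\<forall>a\<in>lp p. \<forall>b\<in>lp p. \<forall>y. \<beta> (\<lambda>n. a n + b n) y = \<beta> a y + \<beta> b y) \<and>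
    (\<forall>c. \<forall>a\<in>lp p. \<forall>y. \<beta> (\<lambda>n. c * a n) y = c * \<beta> a y) \<and>
    (\<forall>a\<in>lp p. \<forall>y z. \<beta> a (y + z) = \<beta> a y + \<beta> a z) \<and>
    (\<forall>c. \<forall>a\<in>lp p. \<forall>y. \<beta> a (sY c y) = c * \<beta> a y)"

type_synonym ('k, 'y) tensor = "((nat \<Rightarrow> 'k) \<Rightarrow> 'y \<Rightarrow> 'k) \<Rightarrow> 'k"

definition elem_tensor ::
  "real \<Rightarrow> ('k::real_normed_field \<Rightarrow> 'y::banach \<Rightarrow> 'y) \<Rightarrow> (nat \<Rightarrow> 'k) \<Rightarrow> 'y \<Rightarrow> ('k, 'y) tensor"
  where "elem_tensor p sY a y = (\<lambda>\<beta>. if bilinear_form p sY \<beta> then \<beta> a y else 0)"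

definition alg_tensor ::
  "real \<Rightarrow> ('k::real_normed_field \<Rightarrow> 'y::banach \<Rightarrow> 'y) \<Rightarrow> ('k, 'y) tensor set"
  where "alg_tensor p sY =
    {u. \<exists>(m::nat) a y. (\<forall>i<m. a i \<in> lp p) \<and>
          u = (\<lambda>\<beta>. \<Sum>i<m. elem_tensor p sY (a i) (y i) \<beta>)}"

(* N is the fixed cross norm on the algebraic tensor product, and the Banach space of type 'z with
   the isometric embedding j (of dense range) is its completion. *)

locale lp_tensor_completion =
  Y: banach_space_over sY + Z: banach_space_over sZ
  for p :: real
    and sY :: "'k::real_normed_field \<Rightarrow> 'y::banach \<Rightarrow> 'y"
    and sZ :: "'k \<Rightarrow> 'z::banach \<Rightarrow> 'z"
    and N :: "('k, 'y) tensor \<Rightarrow> real"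
    and j :: "('k, 'y) tensor \<Rightarrow> 'z" +
  assumes p_ge_1: "1 \<le> p"
    and N_nonneg: "u \<in> alg_tensor p sY \<Longrightarrow> 0 \<le> N u"
    and N_eq_0_iff: "u \<in> alg_tensor p sY \<Longrightarrow> N u = 0 \<longleftrightarrow> u = (\<lambda>\<beta>. 0)"
    and N_scale: "u \<in> alg_tensor p sY \<Longrightarrow> N (\<lambda>\<beta>. c * u \<beta>) = norm c * N u"
    and N_triangle: "u \<in> alg_tensor p sY \<Longrightarrow> v \<in> alg_tensor p sY \<Longrightarrow>
                       N (\<lambda>\<beta>. u \<beta> + v \<beta>) \<le> N u + N v"
    and cross_norm: "a \<in> lp p \<Longrightarrow> N (elem_tensor p sY a y) = lp_norm p a * norm y"
    and j_add: "u \<in> alg_tensor p sY \<Longrightarrow> v \<in> alg_tensor p sY \<Longrightarrow> j (\<lambda>\<beta>. u \<beta> + v \<beta>) = j u + j v"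
    and j_scale: "u \<in> alg_tensor p sY \<Longrightarrow> j (\<lambda>\<beta>. c * u \<beta>) = sZ c (j u)"
    and j_isometry: "u \<in> alg_tensor p sY \<Longrightarrow> norm (j u) = N u"
    and j_dense: "closure (j ` alg_tensor p sY) = UNIV"
    and tensor_operator: "bounded_linear_lp p T \<Longrightarrow> bounded_linear_over sY sY R \<Longrightarrow>
          \<exists>Q. bounded_linear_over sZ sZ Q \<and>
              (\<forall>a\<in>lp p. \<forall>y. Q (j (elem_tensor p sY a y)) = j (elem_tensor p sY (T a) (R y))) \<and>
              onorm Q \<le> lp_onorm p T * onorm R"


(* Sequences are indexed by nat, i.e. from 0 instead of from 1. *)

definition tensor_L ::
  "real \<Rightarrow> ('k::real_normed_field \<Rightarrow> 'y::banach \<Rightarrow> 'y) \<Rightarrow> (('k, 'y) tensor \<Rightarrow> 'z::banach) \<Rightarrow>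
   nat \<Rightarrow> 'y \<Rightarrow> 'z"
  where "tensor_L p sY j n y = j (elem_tensor p sY (lp_basis n) y)"

definition tensor_Gamma ::
  "real \<Rightarrow> ('k::real_normed_field \<Rightarrow> 'y::banach \<Rightarrow> 'y) \<Rightarrow> ('k \<Rightarrow> 'z::banach \<Rightarrow> 'z) \<Rightarrow>
   (('k, 'y) tensor \<Rightarrow> 'z) \<Rightarrow> nat \<Rightarrow> 'z \<Rightarrow> 'y"
  where "tensor_Gamma p sY sZ j n =
    (THE g. bounded_linear_over sZ sY g \<and>
            (\<forall>a\<in>lp p. \<forall>y. g (j (elem_tensor p sY a y)) = sY (a n) y))"

definition frame_op :: "(nat \<Rightarrow> 'x::banach \<Rightarrow> 'y::banach) \<Rightarrow> (nat \<Rightarrow> 'y \<Rightarrow> 'x) \<Rightarrow> 'x \<Rightarrow> 'x"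
  where "frame_op A \<Psi> x = (\<Sum>n. \<Psi> n (A n x))"

definition analysis_op ::
  "real \<Rightarrow> ('k::real_normed_field \<Rightarrow> 'y::banach \<Rightarrow> 'y) \<Rightarrow> (('k, 'y) tensor \<Rightarrow> 'z::banach) \<Rightarrow>
   (nat \<Rightarrow> 'x::banach \<Rightarrow> 'y) \<Rightarrow> 'x \<Rightarrow> 'z"
  where "analysis_op p sY j A x = (\<Sum>n. tensor_L p sY j n (A n x))"

definition synthesis_op ::
  "real \<Rightarrow> ('k::real_normed_field \<Rightarrow> 'y::banach \<Rightarrow> 'y) \<Rightarrow> ('k \<Rightarrow> 'z::banach \<Rightarrow> 'z) \<Rightarrow>
   (('k, 'y) tensor \<Rightarrow> 'z) \<Rightarrow> (nat \<Rightarrow> 'y \<Rightarrow> 'x::banach) \<Rightarrow> 'z \<Rightarrow> 'x"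
  where "synthesis_op p sY sZ j \<Psi> z = (\<Sum>n. \<Psi> n (tensor_Gamma p sY sZ j n z))"

definition op_valued_pASF ::
  "real \<Rightarrow> ('k::real_normed_field \<Rightarrow> 'x::banach \<Rightarrow> 'x) \<Rightarrow> ('k \<Rightarrow> 'y::banach \<Rightarrow> 'y) \<Rightarrow>
   ('k \<Rightarrow> 'z::banach \<Rightarrow> 'z) \<Rightarrow> (('k, 'y) tensor \<Rightarrow> 'z) \<Rightarrow>
   (nat \<Rightarrow> 'x \<Rightarrow> 'y) \<Rightarrow> (nat \<Rightarrow> 'y \<Rightarrow> 'x) \<Rightarrow> bool"
  where "op_valued_pASF p sX sY sZ j A \<Psi> \<longleftrightarrow>
    (\<forall>n. bounded_linear_over sX sY (A n)) \<and>
    (\<forall>n. bounded_linear_over sY sX (\<Psi> n)) \<and>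
    (\<forall>x. summable (\<lambda>n. \<Psi> n (A n x))) \<and>
    bounded_invertible sX (frame_op A \<Psi>) \<and>
    (\<forall>x. summable (\<lambda>n. tensor_L p sY j n (A n x))) \<and>
    bounded_linear_over sX sZ (analysis_op p sY j A) \<and>
    (\<forall>z. summable (\<lambda>n. \<Psi> n (tensor_Gamma p sY sZ j n z))) \<and>
    bounded_linear_over sZ sX (synthesis_op p sY sZ j \<Psi>)"

definition approx_dual_pASF ::
  "real \<Rightarrow> ('k::real_normed_field \<Rightarrow> 'x::banach \<Rightarrow> 'x) \<Rightarrow> ('k \<Rightarrow> 'y::banach \<Rightarrow> 'y) \<Rightarrow>
   ('k \<Rightarrow> 'z::banach \<Rightarrow> 'z) \<Rightarrow> (('k, 'y) tensor \<Rightarrow> 'z) \<Rightarrow>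
   (nat \<Rightarrow> 'x \<Rightarrow> 'y) \<Rightarrow> (nat \<Rightarrow> 'y \<Rightarrow> 'x) \<Rightarrow> (nat \<Rightarrow> 'x \<Rightarrow> 'y) \<Rightarrow> (nat \<Rightarrow> 'y \<Rightarrow> 'x) \<Rightarrow> bool"
  where "approx_dual_pASF p sX sY sZ j A \<Psi> B \<Phi> \<longleftrightarrow>
    op_valued_pASF p sX sY sZ j A \<Psi> \<and>
    op_valued_pASF p sX sY sZ j B \<Phi> \<and>
    onorm (\<lambda>x. x - synthesis_op p sY sZ j \<Phi> (analysis_op p sY j A x)) < 1 \<and>
    onorm (\<lambda>x. x - synthesis_op p sY sZ j \<Psi> (analysis_op p sY j B x)) < 1"

end

theory Submission
  imports Defs
begin

text \<open>
  Write \<open>S = frame_op A \<Psi>\<close>, and \<open>\<theta>A\<close>, \<open>\<theta>B\<close>, \<open>\<theta>\<Psi>\<close>, \<open>\<theta>\<Phi>\<close> for the analysis and synthesis operators.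
  Everything rests on the coordinate operators: \<open>\<Gamma> n\<close> undoes \<open>L n\<close> and kills every other
  \<open>L m\<close> (\<open>Gamma_L\<close>), hence \<open>\<Gamma> n (\<theta>A x) = A n x\<close> and \<open>\<theta>\<Psi> (L n y) = \<Psi> n y\<close>, and synthesis after
  analysis is the series of the products of the coefficient operators; in particular
  \<open>\<theta>\<Psi> \<theta>A = S\<close>. That \<open>\<Gamma> n\<close> exists at all is the part of the argument that uses the hypothesis on
  tensor products of operators.

  Given operators \<open>U\<close>, \<open>V\<close>, \<open>G\<close>, \<open>H\<close>, the formula for \<open>B n\<close> puts into \<open>\<theta>\<Psi> \<theta>B\<close> the three series
  \<open>S S\<inverse> U\<close>, \<open>\<theta>\<Psi> G U\<close> and \<open>- S S\<inverse> \<theta>\<Psi> G U\<close>; the last two cancel, which leaves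
  \<open>\<theta>\<Psi> \<theta>B = U\<close>. In the same way \<open>\<theta>\<Phi> \<theta>A = V\<close>. So the conditions on \<open>U\<close> and \<open>V\<close> are exactly those of
  approximate duality.

  Conversely this forces \<open>U = \<theta>\<Psi> \<theta>B\<close> and \<open>V = \<theta>\<Phi> \<theta>A\<close>. Approximate duality makes both invertible
  (\<open>bounded_invertible_near_id\<close>), and \<open>G = \<theta>B U\<inverse>\<close>, \<open>H = V\<inverse> \<theta>\<Phi>\<close> are then a right inverse of \<open>\<theta>\<Psi>\<close>
  and a left inverse of \<open>\<theta>A\<close>, respectively. Therefore the correction terms collapse: both formulas reduce to
  \<open>B n = \<Gamma> n \<theta>B\<close> and \<open>\<Phi> n = \<theta>\<Phi> L n\<close>, and the operator to be inverted reduces to \<open>H G\<close>, which is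
  \<open>V\<inverse>\<close> times the frame operator of \<open>B\<close> and \<open>\<Phi>\<close> times \<open>U\<inverse>\<close>, a product of invertible operators.
\<close>

section \<open>Bounded operators over the scalar field\<close>

lemma bounded_linear_over_iff:
  "bounded_linear_over s1 s2 f \<longleftrightarrow>
    vector_space s1 \<and> vector_space s2 \<and> bounded_linear f \<and> (\<forall>c x. f (s1 c x) = s2 c (f x))"
  unfolding bounded_linear_over_def Vector_Spaces.linear_iff
  by (auto simp: bounded_linear.linear linear_add)

lemma bounded_linear_over_bounded_linear:
  "bounded_linear_over s1 s2 f \<Longrightarrow> bounded_linear f"
  by (simp add: bounded_linear_over_def)

lemma bounded_linear_over_scale:
  "bounded_linear_over s1 s2 f \<Longrightarrow> f (s1 c x) = s2 c (f x)"
  by (simp add: bounded_linear_over_iff)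

lemma bounded_linear_over_compose:
  assumes "bounded_linear_over s1 s2 f" "bounded_linear_over s2 s3 g"
  shows "bounded_linear_over s1 s3 (\<lambda>x. g (f x))"
  using assms by (auto simp: bounded_linear_over_iff intro: bounded_linear_compose)

text \<open>Compatibility of the scalar multiplications with \<open>of_real\<close> yields real homogeneity, so for a
  bounded operator only homogeneity over the scalar field has to be verified.\<close>

lemma bounded_linear_overI:
  assumes s1: "banach_space_over s1" and s2: "banach_space_over s2"
    and add: "\<And>x y. f (x + y) = f x + f y"
    and scale: "\<And>c x. f (s1 c x) = s2 c (f x)"
    and bound: "\<And>x. norm (f x) \<le> K * norm x"
  shows "bounded_linear_over s1 s2 f"
proof -
  interpret s1: banach_space_over s1 by fact
  interpret s2: banach_space_over s2 by fact
  have "f (r *\<^sub>R x) = r *\<^sub>R f x" for r x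
    by (metis scale s1.scale_of_real s2.scale_of_real)
  then have "bounded_linear f"
    using add bound by (intro bounded_linear_intro[where K = K]) (auto simp: mult.commute)
  then show ?thesis
    using scale s1.vector_space_axioms s2.vector_space_axioms
    by (simp add: bounded_linear_over_iff)
qed

lemma bounded_linear_over_inverse:
  assumes s1: "banach_space_over s1" and s2: "banach_space_over s2"
    and T: "bounded_linear_over s1 s2 T"
    and right: "\<And>y. T (R y) = y" and left: "\<And>x. R (T x) = x"
    and bound: "\<And>y. norm (R y) \<le> K * norm y"
  shows "bounded_linear_over s2 s1 R"
proof (rule bounded_linear_overI[OF s2 s1 _ _ bound])
  interpret T: bounded_linear T
    using T by (rule bounded_linear_over_bounded_linear)
  show "R (x + y) = R x + R y" for x y
    by (metis T.add left right)
  show "R (s2 c x) = s1 c (R x)" for c x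
    by (metis bounded_linear_over_scale[OF T] left right)
qed

lemma bounded_invertible_compose:
  assumes "bounded_invertible s S" "bounded_invertible s T"
  shows "bounded_invertible s (\<lambda>x. S (T x))"
proof -
  obtain S' T' where *: "bounded_linear_over s s S'" "bounded_linear_over s s T'"
    "S \<circ> S' = id" "S' \<circ> S = id" "T \<circ> T' = id" "T' \<circ> T = id"
    using assms by (auto simp: bounded_invertible_def)
  then have "bounded_linear_over s s (\<lambda>x. T' (S' x))"
    "(\<lambda>x. S (T x)) \<circ> (\<lambda>x. T' (S' x)) = id" "(\<lambda>x. T' (S' x)) \<circ> (\<lambda>x. S (T x)) = id"
    by (auto intro: bounded_linear_over_compose simp: fun_eq_iff)
  then show ?thesis
    using assms unfolding bounded_invertible_def by (blast intro: bounded_linear_over_compose)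
qed

lemma bounded_invertible_inv:
  assumes "bounded_invertible s T"
  shows "bounded_invertible s (inv T)" "T (inv T x) = x" "inv T (T x) = x"
proof -
  obtain R where R: "bounded_linear_over s s R" "T \<circ> R = id" "R \<circ> T = id"
    and T: "bounded_linear_over s s T"
    using assms by (auto simp: bounded_invertible_def)
  have "inv T = R"
    using R by (intro inv_unique_comp)
  then show "bounded_invertible s (inv T)" "T (inv T x) = x" "inv T (T x) = x"
    using R T by (auto simp: bounded_invertible_def dest: fun_cong)
qed

text \<open>A fixed point argument in place of the Neumann series: \<open>T x = y\<close> says that \<open>x\<close> is a fixed point of the map
  \<open>x \<mapsto> y + (x - T x)\<close>, which is a contraction, so \<open>T\<close> is a bijection; and
  \<open>norm x \<le> norm (T x) + c * norm x\<close> with \<open>c < 1\<close> bounds its inverse.\<close>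

lemma bounded_invertible_near_id:
  assumes s: "banach_space_over s" and T: "bounded_linear_over s s T"
    and near: "onorm (\<lambda>x. x - T x) < 1"
  shows "bounded_invertible s T"
proof -
  interpret T: bounded_linear T
    using T by (rule bounded_linear_over_bounded_linear)
  define c where "c = onorm (\<lambda>x. x - T x)"
  have bl: "bounded_linear (\<lambda>x. x - T x)"
    by (intro bounded_linear_intros T.bounded_linear_axioms)
  have c: "0 \<le> c" "c < 1"
    using near onorm_pos_le[OF bl] by (auto simp: c_def)
  have le: "norm (x - T x) \<le> c * norm x" for x
    unfolding c_def by (rule onorm[OF bl])
  have ex1: "\<exists>!x. T x = y" for y
  proof -
    have "dist (y + (u - T u)) (y + (v - T v)) \<le> c * dist u v" for u v
    proof -
      have "y + (u - T u) - (y + (v - T v)) = (u - v) - T (u - v)"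
        by (simp add: T.diff)
      then show ?thesis
        using le[of "u - v"] by (simp only: dist_norm)
    qed
    then have "\<exists>!x. y + (x - T x) = x"
      using c by (intro banach_fix_type) auto
    moreover have "y + (x - T x) = x \<longleftrightarrow> T x = y" for x
      by (auto simp: algebra_simps)
    ultimately show ?thesis by simp
  qed
  then have "bij T"
    by (auto simp: bij_iff)
  then have inv: "T (inv T y) = y" "inv T (T x) = x" for x y
    by (simp_all add: bij_is_surj surj_f_inv_f bij_is_inj)
  have "norm (inv T y) \<le> 1 / (1 - c) * norm y" for y
  proof -
    have "norm (inv T y) \<le> norm y + norm (inv T y - T (inv T y))"
      by (metis add.commute inv(1) norm_triangle_sub norm_minus_commute)
    also have "\<dots> \<le> norm y + c * norm (inv T y)"
      using le by simp
    finally show ?thesis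
      using c by (simp add: field_simps)
  qed
  then have "bounded_linear_over s s (inv T)"
    by (rule bounded_linear_over_inverse[OF s s T inv])
  then show ?thesis
    using T inv unfolding bounded_invertible_def by (auto simp: fun_eq_iff)
qed

section \<open>Coordinates in the tensor product\<close>

lemma lp_single:
  shows single_in_lp: "(\<lambda>m. if m = n then x else 0) \<in> lp p"
    and lp_norm_single: "lp_norm p (\<lambda>m. if m = n then x else 0) = (norm x powr p) powr (1 / p)"
proof -
  have "(\<lambda>m. norm (if m = n then x else 0) powr p) = (\<lambda>m. if m = n then norm x powr p else 0)"
    by auto
  moreover have "(\<lambda>m. if m = n then norm x powr p else 0) sums (norm x powr p)"
    using sums_single[of n "\<lambda>_. norm x powr p"] by simp
  ultimately show "(\<lambda>m. if m = n then x else 0) \<in> lp p"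
    "lp_norm p (\<lambda>m. if m = n then x else 0) = (norm x powr p) powr (1 / p)"
    by (auto simp: lp_def lp_norm_def sums_iff)
qed

lemma lp_basis_in_lp: "(lp_basis n :: nat \<Rightarrow> 'k::real_normed_field) \<in> lp p"
  and lp_norm_lp_basis: "lp_norm p (lp_basis n :: nat \<Rightarrow> 'k::real_normed_field) = 1"
  using lp_single[where x = "1::'k" and p = p and n = n]
  by (auto simp: lp_basis_def)

lemma bounded_linear_lp_coordinate_projection:
  assumes "1 \<le> p"
  shows "bounded_linear_lp p (\<lambda>a::nat \<Rightarrow> 'k::real_normed_field. \<lambda>m. if m = n then a n else 0)"
proof -
  have "lp_norm p (\<lambda>m. if m = n then a n else 0) \<le> 1 * lp_norm p a" if "a \<in> lp p" for a :: "nat \<Rightarrow> 'k"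
  proof -
    have "norm (a n) powr p \<le> (\<Sum>m. norm (a m) powr p)"
      using that sum_le_suminf[of "\<lambda>m. norm (a m) powr p" "{n}"] by (simp add: lp_def)
    then show ?thesis
      using assms unfolding lp_norm_single unfolding lp_norm_def by (simp add: powr_mono2)
  qed
  then show ?thesis
    unfolding bounded_linear_lp_def
    using single_in_lp by (intro conjI exI[of _ 1]) (auto simp: fun_eq_iff)
qed

context lp_tensor_completion
begin

abbreviation "tensor a y \<equiv> j (elem_tensor p sY a y)"
abbreviation "L \<equiv> tensor_L p sY j"
abbreviation "\<Gamma> \<equiv> tensor_Gamma p sY sZ j"

lemma elem_tensor_in_alg_tensor:
  assumes "a \<in> lp p"
  shows "elem_tensor p sY a y \<in> alg_tensor p sY"
proof -
  have "elem_tensor p sY a y = (\<lambda>\<beta>. \<Sum>i<(1::nat). elem_tensor p sY a y \<beta>)"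
    by simp
  then show ?thesis
    using assms unfolding alg_tensor_def
    by (intro CollectI exI[of _ 1] exI[of _ "\<lambda>_. a"] exI[of _ "\<lambda>_. y"]) simp
qed

lemma tensor_add_right:
  assumes "a \<in> lp p"
  shows "tensor a (x + y) = tensor a x + tensor a y"
proof -
  have "elem_tensor p sY a (x + y) = (\<lambda>\<beta>. elem_tensor p sY a x \<beta> + elem_tensor p sY a y \<beta>)"
    using assms by (auto simp: elem_tensor_def bilinear_form_def)
  then show ?thesis
    using j_add elem_tensor_in_alg_tensor assms by metis
qed

lemma tensor_scale_right:
  assumes "a \<in> lp p"
  shows "tensor a (sY c y) = sZ c (tensor a y)"
proof -
  have "elem_tensor p sY a (sY c y) = (\<lambda>\<beta>. c * elem_tensor p sY a y \<beta>)"
    using assms by (auto simp: elem_tensor_def bilinear_form_def)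
  then show ?thesis
    using j_scale elem_tensor_in_alg_tensor assms by metis
qed

lemma tensor_coordinate_projection:
  "tensor (\<lambda>m. if m = n then c else 0) y = L n (sY c y)"
proof -
  have "(\<lambda>m. if m = n then c else 0) = (\<lambda>m. c * lp_basis n m)"
    by (auto simp: lp_basis_def)
  then have "elem_tensor p sY (\<lambda>m. if m = n then c else 0) y = elem_tensor p sY (lp_basis n) (sY c y)"
    by (auto simp: elem_tensor_def bilinear_form_def lp_basis_in_lp)
  then show ?thesis
    by (simp add: tensor_L_def)
qed

text \<open>Density in the form of an induction rule. It serves with \<open>W\<close> the set where two bounded operators
  agree, and with \<open>W\<close> the preimage of a closed range.\<close>

lemma elementary_tensors_total:
  assumes "closed W" "0 \<in> W" "\<And>u v. u \<in> W \<Longrightarrow> v \<in> W \<Longrightarrow> u + v \<in> W"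
    and elem: "\<And>a y. a \<in> lp p \<Longrightarrow> tensor a y \<in> W"
  shows "z \<in> W"
proof -
  have "(\<lambda>\<beta>. \<Sum>i<m. elem_tensor p sY (a i) (y i) \<beta>) \<in> alg_tensor p sY \<and>
      j (\<lambda>\<beta>. \<Sum>i<m. elem_tensor p sY (a i) (y i) \<beta>) \<in> W" (is "?u m \<in> _ \<and> _")
    if "\<forall>i<m. a i \<in> lp p" for m :: nat and a y
    using that
  proof (induction m)
    case 0
    have u: "?u 0 \<in> alg_tensor p sY"
      unfolding alg_tensor_def by blast
    then have "j (?u 0) = 0"
      using j_isometry[OF u] N_eq_0_iff[OF u] by simp
    with u show ?case
      using assms(2) by simp
  next
    case (Suc m)
    have "?u (Suc m) \<in> alg_tensor p sY"
      using Suc.prems unfolding alg_tensor_def by blast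
    moreover have "j (?u (Suc m)) = j (?u m) + tensor (a m) (y m)"
      using Suc j_add[of "?u m" "elem_tensor p sY (a m) (y m)"]
      by (simp add: elem_tensor_in_alg_tensor)
    ultimately show ?case
      using Suc assms(3) elem by simp
  qed
  then have "j ` alg_tensor p sY \<subseteq> W"
    by (auto simp: alg_tensor_def)
  then have "closure (j ` alg_tensor p sY) \<subseteq> W"
    using \<open>closed W\<close> by (rule closure_minimal)
  then show ?thesis
    using j_dense by auto
qed

lemma norm_L: "norm (L n y) = norm y"
  unfolding tensor_L_def
  by (simp add: j_isometry elem_tensor_in_alg_tensor lp_basis_in_lp cross_norm lp_norm_lp_basis)

lemma bounded_linear_over_L: "bounded_linear_over sY sZ (L n)"
  by (rule bounded_linear_overI[where K = 1, OF Y.banach_space_over_axioms Z.banach_space_over_axioms])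
    (simp_all add: norm_L, simp_all add: tensor_L_def tensor_add_right tensor_scale_right lp_basis_in_lp)

lemma closed_range_L: "closed (range (L n))"
proof -
  interpret L: bounded_linear "L n"
    using bounded_linear_over_L by (rule bounded_linear_over_bounded_linear)
  have "complete (range (L n))"
    by (rule complete_isometric_image[where e = 1])
      (auto simp: norm_L L.bounded_linear_axioms complete_UNIV)
  then show ?thesis
    by (rule complete_imp_closed)
qed

text \<open>The coordinate projection \<open>P\<close> of the sequence space onto the span of the \<open>n\<close>-th basis vector
  induces an operator \<open>Q = P \<otimes> I\<close>. On elementary tensors its values lie in the range of the
  isometry \<open>L n\<close>, which is closed, so \<open>Q\<close> factors as \<open>L n\<close> after a bounded operator: the
  coordinate operator sought.\<close>

lemma ex_coordinate_operator:
  "\<exists>g. bounded_linear_over sZ sY g \<and> (\<forall>a\<in>lp p. \<forall>y. g (tensor a y) = sY (a n) y)"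
proof -
  have "bounded_linear_over sY sY (\<lambda>y. y)"
    by (simp add: bounded_linear_over_iff Y.vector_space_axioms)
  from tensor_operator[OF bounded_linear_lp_coordinate_projection[OF p_ge_1] this]
  obtain Q where Q: "bounded_linear_over sZ sZ Q"
    and Q_tensor: "\<And>a y. a \<in> lp p \<Longrightarrow> Q (tensor a y) = L n (sY (a n) y)"
    unfolding tensor_coordinate_projection by blast
  interpret Q: bounded_linear Q
    using Q by (rule bounded_linear_over_bounded_linear)
  interpret L: bounded_linear "L n"
    using bounded_linear_over_L by (rule bounded_linear_over_bounded_linear)
  have "z \<in> Q -` range (L n)" for z
  proof (rule elementary_tensors_total)
    show "closed (Q -` range (L n))"
      by (intro closed_vimage closed_range_L Q.continuous_on continuous_on_id)
    show "0 \<in> Q -` range (L n)"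
      using L.zero by (metis Q.zero rangeI vimageI)
    show "u + v \<in> Q -` range (L n)" if "u \<in> Q -` range (L n)" "v \<in> Q -` range (L n)" for u v
      using that by (auto simp: Q.add simp flip: L.add)
  qed (simp add: Q_tensor)
  then have "\<forall>z. \<exists>y. Q z = L n y"
    by (simp add: image_iff)
  then obtain g where Lg: "L n (g z) = Q z" for z
    by metis
  have inj: "x = y" if "L n x = L n y" for x y
    using norm_L[of n "x - y"] that by (simp add: L.diff)
  obtain K where K: "\<And>z. norm (Q z) \<le> K * norm z"
    using Q.bounded by (auto simp: mult.commute)
  have "bounded_linear_over sZ sY g"
  proof (rule bounded_linear_overI[OF Z.banach_space_over_axioms Y.banach_space_over_axioms])
    show "g (x + y) = g x + g y" for x y
      by (rule inj) (simp add: Lg L.add Q.add)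
    show "g (sZ c x) = sY c (g x)" for c x
      by (rule inj)
        (simp add: Lg bounded_linear_over_scale[OF Q] bounded_linear_over_scale[OF bounded_linear_over_L])
    show "norm (g z) \<le> K * norm z" for z
      using K[of z] norm_L[of n "g z"] by (simp add: Lg)
  qed
  moreover have "g (tensor a y) = sY (a n) y" if "a \<in> lp p" for a y
    by (rule inj) (simp add: Lg Q_tensor that)
  ultimately show ?thesis by blast
qed

text \<open>These are the properties in the definite description of \<open>tensor_Gamma\<close>, which is proper because
  elementary tensors determine a bounded operator.\<close>

lemma Gamma:
  shows bounded_linear_over_Gamma: "bounded_linear_over sZ sY (\<Gamma> n)"
    and Gamma_tensor: "a \<in> lp p \<Longrightarrow> \<Gamma> n (tensor a y) = sY (a n) y"
proof -
  have "\<exists>!g. bounded_linear_over sZ sY g \<and> (\<forall>a\<in>lp p. \<forall>y. g (tensor a y) = sY (a n) y)"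
  proof (rule ex_ex1I[OF ex_coordinate_operator])
    fix f g
    assume f: "bounded_linear_over sZ sY f \<and> (\<forall>a\<in>lp p. \<forall>y. f (tensor a y) = sY (a n) y)"
      and g: "bounded_linear_over sZ sY g \<and> (\<forall>a\<in>lp p. \<forall>y. g (tensor a y) = sY (a n) y)"
    interpret f: bounded_linear f
      using f by (blast intro: bounded_linear_over_bounded_linear)
    interpret g: bounded_linear g
      using g by (blast intro: bounded_linear_over_bounded_linear)
    have "z \<in> {z. f z = g z}" for z
    proof (rule elementary_tensors_total)
      show "closed {z. f z = g z}"
        by (intro closed_Collect_eq f.continuous_on g.continuous_on continuous_on_id)
    qed (use f g in \<open>auto simp: f.zero g.zero f.add g.add\<close>)
    then show "f = g" by auto
  qed
  from theI'[OF this]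
  show "bounded_linear_over sZ sY (\<Gamma> n)" "a \<in> lp p \<Longrightarrow> \<Gamma> n (tensor a y) = sY (a n) y"
    unfolding tensor_Gamma_def by auto
qed

lemma Gamma_L: "\<Gamma> n (L m y) = (if n = m then y else 0)"
  by (simp add: tensor_L_def Gamma_tensor lp_basis_in_lp) (simp add: lp_basis_def)

section \<open>Composing synthesis with analysis operators\<close>

text \<open>By continuity \<open>\<Gamma> n\<close> may be applied term by term to the series of the analysis operator, and
  only the \<open>n\<close>-th term survives.\<close>

lemma Gamma_analysis_op:
  assumes "op_valued_pASF p sX sY sZ j A \<Psi>"
  shows "\<Gamma> n (analysis_op p sY j A x) = A n x"
proof -
  have "summable (\<lambda>m. L m (A m x))"
    using assms by (simp add: op_valued_pASF_def)
  then have "\<Gamma> n (analysis_op p sY j A x) = (\<Sum>m. \<Gamma> n (L m (A m x)))"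
    unfolding analysis_op_def
    by (rule bounded_linear.suminf[OF bounded_linear_over_bounded_linear[OF bounded_linear_over_Gamma]])
  also have "\<dots> = (\<Sum>m. if m = n then A m x else 0)"
    by (intro suminf_cong) (simp add: Gamma_L)
  also have "\<dots> = A n x"
    using sums_single[of n "\<lambda>m. A m x"] by (simp add: sums_iff)
  finally show ?thesis .
qed

lemma sums_synthesis_op:
  assumes "op_valued_pASF p sX sY sZ j A \<Psi>"
  shows "(\<lambda>n. \<Psi> n (\<Gamma> n z)) sums synthesis_op p sY sZ j \<Psi> z"
  using assms by (simp add: op_valued_pASF_def synthesis_op_def summable_sums)

text \<open>The two frames may differ: this is what turns the operators in approximate duality, which pair
  the analysis of one frame with the synthesis of the other, into concrete series.\<close>

lemma sums_synthesis_analysis: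
  assumes "op_valued_pASF p sX sY sZ j A \<Psi>" "op_valued_pASF p sX sY sZ j B \<Phi>"
  shows "(\<lambda>n. \<Psi> n (B n x)) sums synthesis_op p sY sZ j \<Psi> (analysis_op p sY j B x)"
  using sums_synthesis_op[OF assms(1), of "analysis_op p sY j B x"]
  by (simp add: Gamma_analysis_op[OF assms(2)])

lemma synthesis_analysis_eq_frame_op:
  assumes "op_valued_pASF p sX sY sZ j A \<Psi>"
  shows "synthesis_op p sY sZ j \<Psi> (analysis_op p sY j A x) = frame_op A \<Psi> x"
  using sums_synthesis_analysis[OF assms assms] by (simp add: frame_op_def sums_iff)

lemma synthesis_op_L:
  assumes "op_valued_pASF p sX sY sZ j A \<Psi>"
  shows "synthesis_op p sY sZ j \<Psi> (L n y) = \<Psi> n y"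
proof -
  have "bounded_linear (\<Psi> m)" for m
    using assms by (auto simp: op_valued_pASF_def intro: bounded_linear_over_bounded_linear)
  then have "(\<lambda>m. \<Psi> m (\<Gamma> m (L n y))) = (\<lambda>m. if m = n then \<Psi> m y else 0)"
    by (auto simp: Gamma_L linear_0 bounded_linear.linear)
  then show ?thesis
    using sums_synthesis_op[OF assms, of "L n y"] sums_single[of n "\<lambda>m. \<Psi> m y"]
    by (simp add: sums_unique2)
qed

end

section \<open>The characterization of approximate duals\<close>

theorem theorem4p5:
  fixes p :: real
    and sX :: "'k::real_normed_field \<Rightarrow> 'x::banach \<Rightarrow> 'x"
    and sY :: "'k \<Rightarrow> 'y::banach \<Rightarrow> 'y"
    and sZ :: "'k \<Rightarrow> 'z::banach \<Rightarrow> 'z"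
    and N :: "('k, 'y) tensor \<Rightarrow> real"
    and j :: "('k, 'y) tensor \<Rightarrow> 'z"
    and A B :: "nat \<Rightarrow> 'x \<Rightarrow> 'y"
    and \<Psi> \<Phi> :: "nat \<Rightarrow> 'y \<Rightarrow> 'x"
  assumes "banach_space_over sX"
    and "lp_tensor_completion p sY sZ N j"
    and "op_valued_pASF p sX sY sZ j A \<Psi>"
    and "op_valued_pASF p sX sY sZ j B \<Phi>"
  shows "approx_dual_pASF p sX sY sZ j A \<Psi> B \<Phi> \<longleftrightarrow>
    (let Sinv = inv (frame_op A \<Psi>);
         \<theta>A = analysis_op p sY j A;
         \<theta>\<Psi> = synthesis_op p sY sZ j \<Psi>;
         L = tensor_L p sY j;
         \<Gamma> = tensor_Gamma p sY sZ j
     in \<exists>U V G H.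
          bounded_linear_over sX sX U \<and> bounded_linear_over sX sX V \<and>
          bounded_linear_over sX sZ G \<and> bounded_linear_over sZ sX H \<and>
          onorm (\<lambda>x. x - U x) < 1 \<and> onorm (\<lambda>x. x - V x) < 1 \<and>
          (\<forall>n x. B n x = A n (Sinv (U x)) + \<Gamma> n (G (U x)) - A n (Sinv (\<theta>\<Psi> (G (U x))))) \<and>
          (\<forall>n y. \<Phi> n y = V (Sinv (\<Psi> n y)) + V (H (L n y)) - V (H (\<theta>A (Sinv (\<Psi> n y))))) \<and>
          bounded_invertible sX (\<lambda>x. Sinv x + H (G x) - H (\<theta>A (Sinv (\<theta>\<Psi> (G x))))))"
proof -
  interpret lp_tensor_completion p sY sZ N j by fact
  note fA = assms(3) and fB = assms(4)
  define S where "S = frame_op A \<Psi>"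
  define \<theta>A where "\<theta>A = analysis_op p sY j A"
  define \<theta>B where "\<theta>B = analysis_op p sY j B"
  define \<theta>\<Psi> where "\<theta>\<Psi> = synthesis_op p sY sZ j \<Psi>"
  define \<theta>\<Phi> where "\<theta>\<Phi> = synthesis_op p sY sZ j \<Phi>"
  note defs = \<theta>A_def \<theta>B_def \<theta>\<Psi>_def \<theta>\<Phi>_def
  have S: "bounded_invertible sX S"
    using fA by (simp add: op_valued_pASF_def S_def)
  note S_inv = bounded_invertible_inv[OF S]
  have op: "bounded_linear_over sX sZ \<theta>A" "bounded_linear_over sX sZ \<theta>B"
    "bounded_linear_over sZ sX \<theta>\<Psi>" "bounded_linear_over sZ sX \<theta>\<Phi>"
    "bounded_linear_over sY sX (\<Psi> n)" "bounded_linear_over sX sX (inv S)" for n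
    using fA fB S_inv(1) by (simp_all add: op_valued_pASF_def bounded_invertible_def defs)
  note bl = op[THEN bounded_linear_over_bounded_linear]
  have dual_iff: "approx_dual_pASF p sX sY sZ j A \<Psi> B \<Phi> \<longleftrightarrow>
      onorm (\<lambda>x. x - \<theta>\<Phi> (\<theta>A x)) < 1 \<and> onorm (\<lambda>x. x - \<theta>\<Psi> (\<theta>B x)) < 1"
    using fA fB by (simp add: approx_dual_pASF_def defs)
  let ?B = "\<lambda>U G n x. A n (inv S (U x)) + \<Gamma> n (G (U x)) - A n (inv S (\<theta>\<Psi> (G (U x))))"
  let ?\<Phi> = "\<lambda>V H n y. V (inv S (\<Psi> n y)) + V (H (L n y)) - V (H (\<theta>A (inv S (\<Psi> n y))))"
  let ?D = "\<lambda>G H x. inv S x + H (G x) - H (\<theta>A (inv S (\<theta>\<Psi> (G x))))"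
  let ?R = "\<exists>U V G H. bounded_linear_over sX sX U \<and> bounded_linear_over sX sX V \<and>
      bounded_linear_over sX sZ G \<and> bounded_linear_over sZ sX H \<and>
      onorm (\<lambda>x. x - U x) < 1 \<and> onorm (\<lambda>x. x - V x) < 1 \<and>
      (\<forall>n x. B n x = ?B U G n x) \<and> (\<forall>n y. \<Phi> n y = ?\<Phi> V H n y) \<and> bounded_invertible sX (?D G H)"
  have "onorm (\<lambda>x. x - \<theta>\<Phi> (\<theta>A x)) < 1 \<and> onorm (\<lambda>x. x - \<theta>\<Psi> (\<theta>B x)) < 1 \<longleftrightarrow> ?R"
  proof
    assume near: "onorm (\<lambda>x. x - \<theta>\<Phi> (\<theta>A x)) < 1 \<and> onorm (\<lambda>x. x - \<theta>\<Psi> (\<theta>B x)) < 1"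
    define U where "U = (\<lambda>x. \<theta>\<Psi> (\<theta>B x))"
    define V where "V = (\<lambda>x. \<theta>\<Phi> (\<theta>A x))"
    have UV: "bounded_linear_over sX sX U" "bounded_linear_over sX sX V"
      unfolding U_def V_def
      by (rule bounded_linear_over_compose[OF op(2,3)], rule bounded_linear_over_compose[OF op(1,4)])
    have U: "bounded_invertible sX U" and V: "bounded_invertible sX V"
      using near UV assms(1) by (auto intro: bounded_invertible_near_id simp: U_def V_def)
    note U_inv = bounded_invertible_inv[OF U] and V_inv = bounded_invertible_inv[OF V]
    define G where "G = (\<lambda>x. \<theta>B (inv U x))"
    define H where "H = (\<lambda>z. inv V (\<theta>\<Phi> z))"
    have GH: "bounded_linear_over sX sZ G" "bounded_linear_over sZ sX H"
      using U_inv(1) V_inv(1) op unfolding G_def H_def bounded_invertible_def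
      by (blast intro: bounded_linear_over_compose)+
    have \<theta>\<Psi>_G: "\<theta>\<Psi> (G x) = x" for x
      using U_inv(2)[of x] by (simp add: G_def U_def)
    have H_\<theta>A: "H (\<theta>A x) = x" for x
      using V_inv(3)[of x] by (simp add: H_def V_def)
    have B: "B n x = ?B U G n x" for n x
      unfolding \<theta>\<Psi>_G by (simp add: G_def U_inv(3) \<theta>B_def Gamma_analysis_op[OF fB])
    have \<Phi>: "\<Phi> n y = ?\<Phi> V H n y" for n y
      unfolding H_\<theta>A by (simp add: H_def V_inv(2) \<theta>\<Phi>_def synthesis_op_L[OF fB])
    have "?D G H = (\<lambda>x. inv V (frame_op B \<Phi> (inv U x)))"
      unfolding H_\<theta>A \<theta>\<Psi>_G
      by (simp add: G_def H_def \<theta>\<Phi>_def \<theta>B_def synthesis_analysis_eq_frame_op[OF fB])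
    moreover have "bounded_invertible sX (frame_op B \<Phi>)"
      using fB by (simp add: op_valued_pASF_def)
    ultimately have "bounded_invertible sX (?D G H)"
      using bounded_invertible_compose[OF V_inv(1) bounded_invertible_compose[OF _ U_inv(1)]]
      by simp
    moreover have "onorm (\<lambda>x. x - U x) < 1" "onorm (\<lambda>x. x - V x) < 1"
      using near by (simp_all add: U_def V_def)
    ultimately show ?R
      using UV GH B \<Phi> by blast
  next
    assume ?R
    then obtain U V G H where V: "bounded_linear_over sX sX V" and H: "bounded_linear_over sZ sX H"
      and near: "onorm (\<lambda>x. x - U x) < 1" "onorm (\<lambda>x. x - V x) < 1"
      and B: "\<And>n x. B n x = ?B U G n x" and \<Phi>: "\<And>n y. \<Phi> n y = ?\<Phi> V H n y"
      by blast
    note sums_A = sums_synthesis_analysis[OF fA fA,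
        unfolded synthesis_analysis_eq_frame_op[OF fA], folded S_def]
    \<comment> \<open>Both series are split along the three terms of the formula; the contributions of \<open>G\<close>, and
      below those of \<open>H\<close>, cancel.\<close>
    have "\<theta>\<Psi> (\<theta>B x) = U x" for x
    proof -
      have "(\<lambda>n. \<Psi> n (B n x)) = (\<lambda>n. \<Psi> n (A n (inv S (U x))) + \<Psi> n (\<Gamma> n (G (U x)))
          - \<Psi> n (A n (inv S (\<theta>\<Psi> (G (U x))))))"
        by (simp add: B linear_add linear_diff bounded_linear.linear[OF bl(5)])
      also have "\<dots> sums (S (inv S (U x)) + \<theta>\<Psi> (G (U x)) - S (inv S (\<theta>\<Psi> (G (U x)))))"
        unfolding \<theta>\<Psi>_def by (intro sums_add sums_diff sums_A sums_synthesis_op[OF fA])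
      also have "\<dots> = U x"
        by (simp add: S_inv(2))
      finally show ?thesis
        using sums_synthesis_analysis[OF fA fB, of x] sums_unique2 by (auto simp: defs)
    qed
    moreover have "\<theta>\<Phi> (\<theta>A x) = V x" for x
    proof -
      note bV = bounded_linear_over_bounded_linear[OF V] and bH = bounded_linear_over_bounded_linear[OF H]
      have L_A: "(\<lambda>n. L n (A n x)) sums \<theta>A x"
        using fA by (simp add: op_valued_pASF_def defs analysis_op_def summable_sums)
      have "(\<lambda>n. ?\<Phi> V H n (A n x)) sums (V (inv S (S x)) + V (H (\<theta>A x)) - V (H (\<theta>A (inv S (S x)))))"
        by (intro sums_add sums_diff bounded_linear.sums[OF bV] bounded_linear.sums[OF bH]
            bounded_linear.sums[OF bl(1)] bounded_linear.sums[OF bl(6)] sums_A L_A)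
      then have "(\<lambda>n. \<Phi> n (A n x)) sums V x"
        by (simp add: S_inv(3) flip: \<Phi>)
      then show ?thesis
        using sums_synthesis_analysis[OF fB fA, of x] sums_unique2 by (auto simp: defs)
    qed
    ultimately show "onorm (\<lambda>x. x - \<theta>\<Phi> (\<theta>A x)) < 1 \<and> onorm (\<lambda>x. x - \<theta>\<Psi> (\<theta>B x)) < 1"
      using near by simp
  qed
  then show ?thesis
    unfolding dual_iff Let_def S_def \<theta>A_def \<theta>\<Psi>_def .
qed

end
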